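(* If $X_1$ and $X_2$ are independent centered infinitely divisible real random variables with finite positive variances, then $$c_+(X_1+X_2)\le\max\{c_+(X_1),c_+(X_2)\},\qquad c_-(X_1+X_2)\le\max\{c_-(X_1),c_-(X_2)\},$$ where the value $\infty$ is allowed.
   Context: For a centered infinitely divisible random variable $W$ with finite variance $V_W>0$, let $K_W(t)=\log\mathbb{E}e^{tW}\in[0,\infty]$. Define $c_+(W)$ as the infimum of all $c\ge0$ such that $K_W(t)\le\frac{V_Wt^2}{2(1-ct)}$ for every $0\le t<1/c$ (with $1/0=\infty$ and $\inf\emptyset=\infty$), and $c_-(W)=c_+(-W)$. *)

theory Defs
  imports "HOL-Probability.Probability"
begin

text \<open>A law is infinitely divisible if for every \<open>n \<ge> 1\<close> it is the law of a sum of \<open>n\<close>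
  independent random variables with a common distribution \<open>\<nu>\<close> (the coordinates under the
  \<open>n\<close>-fold product of \<open>\<nu>\<close>).\<close>

definition infinitely_divisible :: "real measure \<Rightarrow> bool" where
  "infinitely_divisible \<mu> \<longleftrightarrow>
     (\<forall>n::nat. n \<ge> 1 \<longrightarrow>
       (\<exists>\<nu>. real_distribution \<nu> \<and>
            \<mu> = distr (Pi\<^sub>M {..<n} (\<lambda>_. \<nu>)) borel (\<lambda>x. \<Sum>i<n. x i)))"

definition ln_ennreal :: "ennreal \<Rightarrow> ereal" where
  "ln_ennreal x =
     (if x = 0 then -\<infinity> else if x = \<infinity> then \<infinity> else ereal (ln (enn2real x)))"

text \<open>The expectation is a nonnegative Lebesgue integral, so that it takes the value \<open>\<infinity>\<close> when
  \<open>exp (t * W)\<close> is not integrable.\<close>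

definition cgf :: "'a measure \<Rightarrow> ('a \<Rightarrow> real) \<Rightarrow> real \<Rightarrow> ereal" where
  "cgf M W t = ln_ennreal (\<integral>\<^sup>+ \<omega>. ennreal (exp (t * W \<omega>)) \<partial>M)"

text \<open>On extended reals, \<open>1 / 0 = \<infinity>\<close> and \<open>Inf {} = \<infinity>\<close>.\<close>

definition c_plus :: "'a measure \<Rightarrow> ('a \<Rightarrow> real) \<Rightarrow> ereal" where
  "c_plus M W =
     Inf {ereal c | c. c \<ge> 0 \<and>
       (\<forall>t\<ge>0. ereal t < 1 / ereal c \<longrightarrow>
          cgf M W t \<le> ereal (prob_space.variance M W * t\<^sup>2 / (2 * (1 - c * t))))}"

definition c_minus :: "'a measure \<Rightarrow> ('a \<Rightarrow> real) \<Rightarrow> ereal" where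
  "c_minus M W = c_plus M (\<lambda>\<omega>. - W \<omega>)"

end

theory Submission
  imports Defs
begin

text \<open>Call \<open>c\<close> admissible for \<open>W\<close> if it satisfies the bound whose
  infimum defines \<open>c_plus\<close>. Under independence both the log-moment generating function
  and the variance are additive. For fixed \<open>c\<close> and \<open>t\<close> the bound is linear
  in the variance, so adding the bounds of the two summands gives exactly the bound of the sum: a
  common admissible constant is admissible for the sum (\<open>c_plus_admissible_add\<close>).
  Admissible constants are closed upwards (\<open>c_plus_admissible_mono\<close>), so if
  \<open>c\<close> and \<open>d\<close> are admissible for the two summands, \<open>max c d\<close>
  is a common one; passing to infima gives the claim. The left-hand version is the same statement
  for the negated variables.\<close>

definition c_plus_admissible :: "'a measure \<Rightarrow> ('a \<Rightarrow> real) \<Rightarrow> real \<Rightarrow> bool" where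
  "c_plus_admissible M W c \<longleftrightarrow> c \<ge> 0 \<and>
     (\<forall>t\<ge>0. ereal t < 1 / ereal c \<longrightarrow>
        cgf M W t \<le> ereal (prob_space.variance M W * t\<^sup>2 / (2 * (1 - c * t))))"

lemma c_plus_eq_Inf: "c_plus M W = Inf {ereal c | c. c_plus_admissible M W c}"
  by (simp add: c_plus_def c_plus_admissible_def)

text \<open>The real form of the range of \<open>t\<close> treats \<open>c = 0\<close>, where the
  extended quotient is infinite, together with \<open>c > 0\<close>.\<close>

lemma less_one_div_ereal_iff:
  assumes "c \<ge> 0" "t \<ge> 0"
  shows "ereal t < 1 / ereal c \<longleftrightarrow> c * t < 1"
proof (cases "c = 0")
  case True
  then show ?thesis by (simp add: divide_ereal_def zero_ereal_def[symmetric])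
next
  case False
  with assms have "c > 0" by simp
  then have "1 / ereal c = ereal (1 / c)"
    by (simp add: one_ereal_def)
  with \<open>c > 0\<close> show ?thesis by (simp add: field_simps)
qed

text \<open>Real upper bounds force both factors to be finite, so neither the product of zero and
  infinity nor the sum of opposite infinities arises. A zero factor gives minus infinity; otherwise
  this is the usual law for \<open>ln\<close>.\<close>

lemma ln_ennreal_mult_le:
  assumes "ln_ennreal a \<le> ereal x" "ln_ennreal b \<le> ereal y"
  shows "ln_ennreal (a * b) \<le> ereal (x + y)"
proof (cases "a = 0 \<or> b = 0")
  case True
  then show ?thesis by (auto simp: ln_ennreal_def)
next
  case False
  moreover have "a \<noteq> \<infinity>" "b \<noteq> \<infinity>"
    using assms by (auto simp: ln_ennreal_def split: if_splits)
  ultimately have "enn2real a > 0" "enn2real b > 0" "a * b \<noteq> \<infinity>" "a * b \<noteq> 0"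
    by (auto simp: enn2real_positive_iff ennreal_mult_eq_top_iff less_top zero_less_iff_neq_zero)
  moreover from False \<open>a \<noteq> \<infinity>\<close> \<open>b \<noteq> \<infinity>\<close> have "ln (enn2real a) \<le> x" "ln (enn2real b) \<le> y"
    using assms by (auto simp: ln_ennreal_def)
  ultimately show ?thesis
    using False by (auto simp: ln_ennreal_def enn2real_mult ln_mult)
qed

context prob_space
begin

text \<open>The joint law is a product measure, so Tonelli applies. Working with nonnegative
  integrals covers infinite exponential moments too.\<close>

lemma indep_var_nn_integral_mult:
  fixes f g :: "'b \<Rightarrow> ennreal"
  assumes indep: "indep_var S X T Y"
    and [measurable]: "f \<in> borel_measurable S" "g \<in> borel_measurable T"
  shows "(\<integral>\<^sup>+ \<omega>. f (X \<omega>) * g (Y \<omega>) \<partial>M) = (\<integral>\<^sup>+ \<omega>. f (X \<omega>) \<partial>M) * (\<integral>\<^sup>+ \<omega>. g (Y \<omega>) \<partial>M)"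
proof -
  have [measurable]: "random_variable S X" "random_variable T Y"
    and eq: "distr M S X \<Otimes>\<^sub>M distr M T Y = distr M (S \<Otimes>\<^sub>M T) (\<lambda>\<omega>. (X \<omega>, Y \<omega>))"
    using indep by (auto simp: indep_var_distribution_eq)
  interpret Y: prob_space "distr M T Y" by (rule prob_space_distr) simp
  have "(\<integral>\<^sup>+ \<omega>. f (X \<omega>) * g (Y \<omega>) \<partial>M)
      = (\<integral>\<^sup>+ z. f (fst z) * g (snd z) \<partial>distr M (S \<Otimes>\<^sub>M T) (\<lambda>\<omega>. (X \<omega>, Y \<omega>)))"
    by (simp add: nn_integral_distr)
  also have "\<dots> = (\<integral>\<^sup>+ x. \<integral>\<^sup>+ y. f x * g y \<partial>distr M T Y \<partial>distr M S X)"
    unfolding eq[symmetric] by (subst Y.nn_integral_fst[symmetric]) simp_all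
  also have "\<dots> = (\<integral>\<^sup>+ x. f x \<partial>distr M S X) * (\<integral>\<^sup>+ y. g y \<partial>distr M T Y)"
    by (simp add: nn_integral_cmult nn_integral_multc)
  finally show ?thesis by (simp add: nn_integral_distr)
qed

lemma cgf_add_le:
  assumes "indep_var borel X borel Y"
    and "cgf M X t \<le> ereal x" "cgf M Y t \<le> ereal y"
  shows "cgf M (\<lambda>\<omega>. X \<omega> + Y \<omega>) t \<le> ereal (x + y)"
proof -
  have "(\<integral>\<^sup>+ \<omega>. ennreal (exp (t * (X \<omega> + Y \<omega>))) \<partial>M)
      = (\<integral>\<^sup>+ \<omega>. ennreal (exp (t * X \<omega>)) \<partial>M) * (\<integral>\<^sup>+ \<omega>. ennreal (exp (t * Y \<omega>)) \<partial>M)"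
    using indep_var_nn_integral_mult[OF assms(1), of "\<lambda>x. ennreal (exp (t * x))" "\<lambda>x. ennreal (exp (t * x))"]
    by (simp add: distrib_left exp_add ennreal_mult)
  then show ?thesis
    using assms(2,3) ln_ennreal_mult_le by (simp add: cgf_def)
qed

text \<open>Square integrability gives integrable means on a probability space, and independence
  makes the cross term integrable with expectation the product of the means, so the covariance
  vanishes.\<close>

lemma indep_var_variance_add:
  fixes X Y :: "'a \<Rightarrow> real"
  assumes indep: "indep_var borel X borel Y"
    and X2: "integrable M (\<lambda>\<omega>. (X \<omega>)\<^sup>2)" and Y2: "integrable M (\<lambda>\<omega>. (Y \<omega>)\<^sup>2)"
  shows "variance (\<lambda>\<omega>. X \<omega> + Y \<omega>) = variance X + variance Y"
proof -
  have rv [measurable]: "random_variable borel X" "random_variable borel Y"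
    using indep by (auto dest: indep_var_rv1 indep_var_rv2)
  have int: "integrable M X" "integrable M Y"
    using X2 Y2 by (auto intro: square_integrable_imp_integrable)
  have XY: "integrable M (\<lambda>\<omega>. X \<omega> * Y \<omega>)"
    "expectation (\<lambda>\<omega>. X \<omega> * Y \<omega>) = expectation X * expectation Y"
    using indep_var_integrable[OF indep int] indep_var_lebesgue_integral[OF indep int] by auto
  have sq: "(\<lambda>\<omega>. (X \<omega> + Y \<omega>)\<^sup>2) = (\<lambda>\<omega>. (X \<omega>)\<^sup>2 + (Y \<omega>)\<^sup>2 + 2 * (X \<omega> * Y \<omega>))"
    by (auto simp: power2_eq_square algebra_simps)
  then have "integrable M (\<lambda>\<omega>. (X \<omega> + Y \<omega>)\<^sup>2)"
    using X2 Y2 XY by simp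
  then have "variance (\<lambda>\<omega>. X \<omega> + Y \<omega>)
      = expectation (\<lambda>\<omega>. (X \<omega> + Y \<omega>)\<^sup>2) - (expectation X + expectation Y)\<^sup>2"
    using int by (subst variance_eq) simp_all
  moreover have "expectation (\<lambda>\<omega>. (X \<omega> + Y \<omega>)\<^sup>2)
      = expectation (\<lambda>\<omega>. (X \<omega>)\<^sup>2) + expectation (\<lambda>\<omega>. (Y \<omega>)\<^sup>2) + 2 * (expectation X * expectation Y)"
    using X2 Y2 XY by (simp add: sq)
  ultimately show ?thesis
    using X2 Y2 int by (simp add: variance_eq power2_sum)
qed

text \<open>Enlarging the constant shrinks the range of \<open>t\<close> and, since
  \<open>t \<ge> 0\<close>, also the denominator, so the bound only weakens.\<close>

lemma c_plus_admissible_mono: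
  assumes "c_plus_admissible M W c" "c \<le> d"
  shows "c_plus_admissible M W d"
  unfolding c_plus_admissible_def
proof (intro conjI allI impI)
  show "d \<ge> 0" using assms by (simp add: c_plus_admissible_def)
  fix t :: real
  assume t: "0 \<le> t" "ereal t < 1 / ereal d"
  from assms have c: "0 \<le> c" by (simp add: c_plus_admissible_def)
  have le: "c * t \<le> d * t" using assms t by (simp add: mult_right_mono)
  have dt: "d * t < 1" using t \<open>d \<ge> 0\<close> less_one_div_ereal_iff by blast
  then have "ereal t < 1 / ereal c" using c t le less_one_div_ereal_iff by simp
  then have "cgf M W t \<le> ereal (variance W * t\<^sup>2 / (2 * (1 - c * t)))"
    using assms t by (simp add: c_plus_admissible_def)
  \<comment> \<open>Both denominators are positive because \<open>c * t \<le> d * t < 1\<close>, and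
    the numerator is nonnegative.\<close>
  also have "variance W * t\<^sup>2 / (2 * (1 - c * t)) \<le> variance W * t\<^sup>2 / (2 * (1 - d * t))"
    using le dt by (intro divide_left_mono mult_nonneg_nonneg) (auto intro!: variance_positive)
  finally show "cgf M W t \<le> ereal (variance W * t\<^sup>2 / (2 * (1 - d * t)))" by simp
qed

text \<open>With the same \<open>c\<close> the two bounds share a denominator, and their numerators
  add up to the variance of the sum times the square of \<open>t\<close>.\<close>

lemma c_plus_admissible_add:
  assumes indep: "indep_var borel X borel Y"
    and "integrable M (\<lambda>\<omega>. (X \<omega>)\<^sup>2)" "integrable M (\<lambda>\<omega>. (Y \<omega>)\<^sup>2)"
    and "c_plus_admissible M X c" "c_plus_admissible M Y c"
  shows "c_plus_admissible M (\<lambda>\<omega>. X \<omega> + Y \<omega>) c"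
  using assms cgf_add_le[OF indep]
  by (simp add: c_plus_admissible_def indep_var_variance_add distrib_right add_divide_distrib)

lemma c_plus_add_le_max:
  assumes indep: "indep_var borel X borel Y"
    and X2: "integrable M (\<lambda>\<omega>. (X \<omega>)\<^sup>2)" and Y2: "integrable M (\<lambda>\<omega>. (Y \<omega>)\<^sup>2)"
  shows "c_plus M (\<lambda>\<omega>. X \<omega> + Y \<omega>) \<le> max (c_plus M X) (c_plus M Y)"
\<comment> \<open>Testing against every \<open>y\<close> strictly above the maximum yields
  admissible real constants below \<open>y\<close> without assuming that the infima are attained. If
  the maximum is infinite, no such \<open>y\<close> exists and the claim is vacuous.\<close>
proof (rule dense_ge)
  fix y assume "max (c_plus M X) (c_plus M Y) < y"
  then obtain c d where c: "c_plus_admissible M X c" "ereal c < y"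
    and d: "c_plus_admissible M Y d" "ereal d < y"
    by (auto simp: c_plus_eq_Inf Inf_less_iff)
  have "c_plus_admissible M (\<lambda>\<omega>. X \<omega> + Y \<omega>) (max c d)"
    using c(1) d(1) by (intro c_plus_admissible_add[OF assms]) (auto elim: c_plus_admissible_mono)
  then have "c_plus M (\<lambda>\<omega>. X \<omega> + Y \<omega>) \<le> ereal (max c d)"
    unfolding c_plus_eq_Inf by (intro Inf_lower) blast
  also have "\<dots> \<le> y" using c(2) d(2) by (auto simp: max_def)
  finally show "c_plus M (\<lambda>\<omega>. X \<omega> + Y \<omega>) \<le> y" .
qed

lemma c_minus_add_le_max:
  assumes indep: "indep_var borel X borel Y"
    and X2: "integrable M (\<lambda>\<omega>. (X \<omega>)\<^sup>2)" and Y2: "integrable M (\<lambda>\<omega>. (Y \<omega>)\<^sup>2)"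
  shows "c_minus M (\<lambda>\<omega>. X \<omega> + Y \<omega>) \<le> max (c_minus M X) (c_minus M Y)"
proof -
  \<comment> \<open>Negation preserves independence, leaves the squares unchanged and distributes
    over the sum, so the bound for \<open>c_plus\<close> applies to the negated variables.\<close>
  have "indep_var borel (\<lambda>\<omega>. - X \<omega>) borel (\<lambda>\<omega>. - Y \<omega>)"
    using indep_var_compose[OF indep, of uminus borel uminus borel] by (simp add: comp_def)
  from c_plus_add_le_max[OF this] X2 Y2 show ?thesis
    by (simp add: c_minus_def)
qed

end

theorem proposition4p2:
  fixes M :: "'a measure" and X1 X2 :: "'a \<Rightarrow> real"
  assumes "prob_space M"
    and "X1 \<in> borel_measurable M" and "X2 \<in> borel_measurable M"
    and "prob_space.indep_var M borel X1 borel X2"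
    and "infinitely_divisible (distr M borel X1)" and "infinitely_divisible (distr M borel X2)"
    and "integrable M (\<lambda>\<omega>. (X1 \<omega>)\<^sup>2)" and "integrable M (\<lambda>\<omega>. (X2 \<omega>)\<^sup>2)"
    and "prob_space.expectation M X1 = 0" and "prob_space.expectation M X2 = 0"
    and "prob_space.variance M X1 > 0" and "prob_space.variance M X2 > 0"
  shows "c_plus M (\<lambda>\<omega>. X1 \<omega> + X2 \<omega>) \<le> max (c_plus M X1) (c_plus M X2)
    \<and> c_minus M (\<lambda>\<omega>. X1 \<omega> + X2 \<omega>) \<le> max (c_minus M X1) (c_minus M X2)"
proof -
  interpret prob_space M by fact
  show ?thesis
    using assms(4,7,8) by (simp add: c_plus_add_le_max c_minus_add_le_max)
qed

end
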